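(* Let $I \subseteq \mathbb{R}$ be an open interval and $a \in I$. If $S : I \to \mathbb{R}$ satisfies $\mathbf{XX}$ on $I$, with $S(a) = 0$ and $S(t) > 0$ for all $t \in I \setminus \{a\}$, then $s := \sqrt{S}$ (the non-negative square-root) does not satisfy $\mathbf{PII}_0$ at $a$; that is, it is not the case that $s$ is twice differentiable at $a$ with $s''(a) = 2 s(a)^3 + a\, s(a)$.
   Context: Everything is real: $t$ is a real variable and solutions are real-valued. The homogeneous second Painlevé equation $\mathbf{PII}_0$ is $$s'' = 2 s^3 + t s.$$ Equation $\mathbf{XX}$ is $$S'' = \frac{(S')^2}{2S} + 4 S^2 + 2 t S,$$ where the ratio $(S')^2/(2S)$ is understood as a limit at zeros of $S$. Precisely, a solution to $\mathbf{XX}$ on an open interval $I$ is a twice-differentiable function $S : I \to \mathbb{R}$ such that (i) at every $t \in I$ with $S(t) \neq 0$ one has $S''(t) = \frac{S'(t)^2}{2S(t)} + 4S(t)^2 + 2tS(t)$; and (ii) at every isolated zero $a \in I$ of $S$ the limit $\lim_{t \to a,\, t\neq a} \frac{S'(t)^2}{2S(t)}$ exists as a real number and $S''(a) = \lim_{t \to a} \frac{S'(t)^2}{2S(t)} + 4S(a)^2 + 2aS(a)$. *)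

theory Defs
  imports "HOL-Analysis.Analysis"
begin

text \<open>A second derivative at a point presupposes a first derivative on a whole neighbourhood of
  that point. All functions below are total; on an open set their values elsewhere are irrelevant.\<close>

definition twice_differentiable_at :: "(real \<Rightarrow> real) \<Rightarrow> real \<Rightarrow> bool" where
  "twice_differentiable_at f t \<longleftrightarrow>
     (\<forall>\<^sub>F u in nhds t. f differentiable (at u)) \<and> deriv f differentiable (at t)"

definition satisfies_PII0_at :: "(real \<Rightarrow> real) \<Rightarrow> real \<Rightarrow> bool" where
  "satisfies_PII0_at s t \<longleftrightarrow>
     twice_differentiable_at s t \<and> deriv (deriv s) t = 2 * s t ^ 3 + t * s t"

text \<open>The quotient in \<open>S'' = (S')\<^sup>2 / (2 S) + 4 S\<^sup>2 + 2 t S\<close> is read literally where \<open>S\<close> does not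
  vanish and as a (finite, existing) limit at the isolated zeros of \<open>S\<close>. Nothing beyond twice
  differentiability is required at non-isolated zeros.\<close>

definition satisfies_XX_on :: "(real \<Rightarrow> real) \<Rightarrow> real set \<Rightarrow> bool" where
  "satisfies_XX_on S I \<longleftrightarrow>
     (\<forall>t\<in>I. twice_differentiable_at S t) \<and>
     (\<forall>t\<in>I. S t \<noteq> 0 \<longrightarrow>
        deriv (deriv S) t = (deriv S t)\<^sup>2 / (2 * S t) + 4 * (S t)\<^sup>2 + 2 * t * S t) \<and>
     (\<forall>a. a isolated_in {t \<in> I. S t = 0} \<longrightarrow>
        (\<exists>L. ((\<lambda>t. (deriv S t)\<^sup>2 / (2 * S t)) \<longlongrightarrow> L) (at a) \<and>
             deriv (deriv S) a = L + 4 * (S a)\<^sup>2 + 2 * a * S a))"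

end

theory Submission
  imports Defs
begin

text \<open>
  Put \<open>s = sqrt S\<close>. Away from \<open>a\<close> the equation \<open>XX\<close> for \<open>S = s\<^sup>2\<close> is the equation
  \<open>s'' = 2 s\<^sup>3 + t s\<close> for \<open>s\<close>, which is linear homogeneous, \<open>s'' = q s\<close>, with the locally
  bounded coefficient \<open>q = 2 S + t\<close>. If \<open>s\<close> were twice differentiable at \<open>a\<close>, then \<open>s(a) = 0\<close>
  and, since \<open>s\<close> has a minimum there, \<open>s'(a) = 0\<close>. A solution with vanishing initial data
  is zero, which contradicts \<open>S > 0\<close> off \<open>a\<close>.

  The uniqueness argument is a Gronwall estimate for the energy \<open>s\<^sup>2 + s'\<^sup>2\<close>, written in terms
  of \<open>S\<close> as \<open>E = S + S'\<^sup>2 / (4 S)\<close> so that nothing has to be known about \<open>s''\<close> off \<open>a\<close>.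
  \<open>XX\<close> reduces its derivative to \<open>E' = S' (1 + 2 S + t)\<close>
  (lemma \<open>XX_energy_has_derivative\<close>), while \<open>\<bar>S'\<bar> = 2 \<bar>s s'\<bar> \<le> E\<close>
  (lemma \<open>abs_le_energy\<close>). Hence \<open>E' \<le> M E\<close> to the right of \<open>a\<close>. Twice differentiability of
  \<open>s\<close> enters only through \<open>E(t) \<longlongrightarrow> 0\<close> as \<open>t\<close> decreases to \<open>a\<close> (lemma
  \<open>sqrt_minimum_quotient_tendsto\<close>).
\<close>

text \<open>\<open>E(t) exp(- M t)\<close> does not increase and tends to \<open>0\<close> at the left end. The initial value is
  given as a limit because the energy to which this is applied contains the quotient
  \<open>S'\<^sup>2 / (4 S)\<close>, which has the form \<open>0 / 0\<close> at \<open>a\<close>.\<close>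

lemma gronwall_zero_at_right:
  fixes E :: "real \<Rightarrow> real"
  assumes "a < b"
    and deriv: "\<And>t. a < t \<Longrightarrow> t \<le> b \<Longrightarrow> (E has_real_derivative E' t) (at t)"
    and le: "\<And>t. a < t \<Longrightarrow> t \<le> b \<Longrightarrow> E' t \<le> M * E t"
    and lim: "(E \<longlongrightarrow> 0) (at_right a)"
  shows "E b \<le> 0"
proof -
  define F where "F t = E t * exp (- M * t)" for t
  have dF: "(F has_real_derivative (E' t - M * E t) * exp (- M * t)) (at t)"
    if "a < t" "t \<le> b" for t
    unfolding F_def using that
    by (auto intro!: derivative_eq_intros deriv simp: algebra_simps)
  have mono: "F b \<le> F t" if "a < t" "t \<le> b" for t
  proof (rule DERIV_nonpos_imp_nonincreasing[OF that(2)])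
    fix x assume "t \<le> x" "x \<le> b"
    then show "\<exists>y. DERIV F x :> y \<and> y \<le> 0"
      using dF[of x] le[of x] that by (intro exI conjI) (auto simp: mult_le_0_iff)
  qed
  have "(F \<longlongrightarrow> 0 * exp (- M * a)) (at_right a)"
    unfolding F_def by (intro tendsto_intros lim)
  moreover have "\<forall>\<^sub>F t in at_right a. F b \<le> F t"
    using \<open>a < b\<close> mono by (auto simp: eventually_at_right_field intro!: exI[of _ b])
  ultimately have "F b \<le> 0"
    using tendsto_lowerbound by fastforce
  then show ?thesis by (simp add: F_def mult_le_0_iff)
qed

lemma twice_differentiable_at_DERIV:
  assumes "twice_differentiable_at f t"
  shows "(f has_real_derivative deriv f t) (at t)"
    and "(deriv f has_real_derivative deriv (deriv f) t) (at t)"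
  using assms unfolding twice_differentiable_at_def
  by (auto dest: eventually_nhds_x_imp_x simp: DERIV_deriv_iff_real_differentiable)

text \<open>The last two summands of the derivative of \<open>S + S'\<^sup>2 / (4 S)\<close> are \<open>S' / (2 S)\<close> times
  \<open>S'' - S'\<^sup>2 / (2 S)\<close>, and \<open>XX\<close> replaces this second factor by \<open>4 S\<^sup>2 + 2 t S\<close>; the
  division by \<open>S\<close> then disappears.\<close>

lemma XX_energy_has_derivative:
  fixes S :: "real \<Rightarrow> real"
  assumes "twice_differentiable_at S t" and "S t \<noteq> 0"
    and "deriv (deriv S) t = (deriv S t)\<^sup>2 / (2 * S t) + 4 * (S t)\<^sup>2 + 2 * t * S t"
  shows "((\<lambda>t. S t + (deriv S t)\<^sup>2 / (4 * S t)) has_real_derivative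
           deriv S t * (1 + 2 * S t + t)) (at t)"
proof -
  note twice_differentiable_at_DERIV[OF assms(1), derivative_intros]
  have "((\<lambda>t. S t + (deriv S t)\<^sup>2 / (4 * S t)) has_real_derivative
      deriv S t + (2 * deriv S t * deriv (deriv S) t * (4 * S t)
        - (deriv S t)\<^sup>2 * (4 * deriv S t)) / (4 * S t)\<^sup>2) (at t)"
    using \<open>S t \<noteq> 0\<close> by (auto intro!: derivative_eq_intros simp: power2_eq_square)
  also have "deriv S t + (2 * deriv S t * deriv (deriv S) t * (4 * S t)
        - (deriv S t)\<^sup>2 * (4 * deriv S t)) / (4 * S t)\<^sup>2
      = deriv S t * (1 + 2 * S t + t)"
    unfolding assms(3) using \<open>S t \<noteq> 0\<close>
    by (simp add: field_simps power2_eq_square)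
  finally show ?thesis .
qed

text \<open>For \<open>x = s\<^sup>2\<close> and \<open>y = 2 s s'\<close> this is \<open>2 \<bar>s s'\<bar> \<le> s\<^sup>2 + s'\<^sup>2\<close>.\<close>

lemma abs_le_energy:
  fixes x y :: real
  assumes "x > 0"
  shows "\<bar>y\<bar> \<le> x + y\<^sup>2 / (4 * x)"
proof -
  have "4 * x * \<bar>y\<bar> \<le> 4 * x * x + y\<^sup>2"
    using zero_le_power2[of "2 * x - \<bar>y\<bar>"] by (simp add: power2_eq_square algebra_simps)
  then show ?thesis using assms by (simp add: field_simps)
qed

text \<open>Off \<open>a\<close> the quotient is \<open>s'\<^sup>2\<close> for \<open>s = sqrt S\<close>. As \<open>s'\<close> is continuous at \<open>a\<close>, its limit
  there is \<open>s'(a)\<^sup>2\<close>, and \<open>s'(a) = 0\<close> because \<open>s\<close> has a minimum at \<open>a\<close>.\<close>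

lemma sqrt_minimum_quotient_tendsto:
  fixes S :: "real \<Rightarrow> real"
  assumes s: "twice_differentiable_at (\<lambda>t. sqrt (S t)) a"
    and "S a = 0"
    and pos: "\<forall>\<^sub>F t in at a. S t > 0 \<and> S differentiable (at t)"
  shows "((\<lambda>t. (deriv S t)\<^sup>2 / (4 * S t)) \<longlongrightarrow> 0) (at a)"
proof -
  define s where "s = (\<lambda>t. sqrt (S t))"
  have ds: "(s has_real_derivative deriv s a) (at a)"
    "(deriv s has_real_derivative deriv (deriv s) a) (at a)"
    using twice_differentiable_at_DERIV[OF s] by (simp_all add: s_def)
  obtain d where "d > 0" and d: "\<And>t. t \<noteq> a \<Longrightarrow> dist t a < d \<Longrightarrow> S t > 0"
    using pos by (auto simp: eventually_at)
  have "\<forall>t. \<bar>a - t\<bar> < d \<longrightarrow> s a \<le> s t"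
  proof (intro allI impI)
    fix t assume "\<bar>a - t\<bar> < d"
    then show "s a \<le> s t"
      using d[of t] \<open>S a = 0\<close>
      by (cases "t = a") (auto simp: s_def dist_real_def abs_minus_commute less_imp_le)
  qed
  then have "deriv s a = 0"
    using DERIV_local_min[OF ds(1) \<open>d > 0\<close>] by blast
  moreover have "(deriv s \<longlongrightarrow> deriv s a) (at a)"
    using DERIV_isCont[OF ds(2)] by (simp add: isCont_def)
  ultimately have "((\<lambda>t. (deriv s t)\<^sup>2) \<longlongrightarrow> 0) (at a)"
    using tendsto_power[of "deriv s" 0 "at a" 2] by simp
  moreover have "\<forall>\<^sub>F t in at a. (deriv s t)\<^sup>2 = (deriv S t)\<^sup>2 / (4 * S t)"
    using pos
  proof eventually_elim
    case (elim t)
    then have "(S has_real_derivative deriv S t) (at t)"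
      by (simp add: DERIV_deriv_iff_real_differentiable)
    then have "(s has_real_derivative deriv S t / (2 * sqrt (S t))) (at t)"
      unfolding s_def using elim
      by (auto intro!: derivative_eq_intros simp: field_simps)
    then have "deriv s t = deriv S t / (2 * sqrt (S t))"
      by (rule DERIV_imp_deriv)
    then show ?case
      using elim by (simp add: power_divide power_mult_distrib)
  qed
  ultimately show ?thesis
    by (rule Lim_transform_eventually)
qed

theorem theorem5:
  fixes I :: "real set" and a :: real and S :: "real \<Rightarrow> real"
  assumes "open I" and "is_interval I" and "a \<in> I"
    and "satisfies_XX_on S I"
    and "S a = 0"
    and "\<And>t. t \<in> I - {a} \<Longrightarrow> S t > 0"
  shows "\<not> satisfies_PII0_at (\<lambda>t. sqrt (S t)) a"
proof
  assume "satisfies_PII0_at (\<lambda>t. sqrt (S t)) a"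
  then have s: "twice_differentiable_at (\<lambda>t. sqrt (S t)) a"
    by (simp add: satisfies_PII0_at_def)
  have twice: "twice_differentiable_at S t" if "t \<in> I" for t
    using assms(4) that by (simp add: satisfies_XX_on_def)
  have XX: "deriv (deriv S) t = (deriv S t)\<^sup>2 / (2 * S t) + 4 * (S t)\<^sup>2 + 2 * t * S t"
    if "t \<in> I" "S t \<noteq> 0" for t
    using assms(4) that by (simp add: satisfies_XX_on_def)
  note dS = twice_differentiable_at_DERIV(1)[OF twice]

  obtain d where "d > 0" and d: "cball a d \<subseteq> I"
    using \<open>open I\<close> \<open>a \<in> I\<close> open_contains_cball by blast
  define b where "b = a + d"
  have "a < b" using \<open>d > 0\<close> by (simp add: b_def)
  have sub: "{a..b} \<subseteq> I"
    using d by (auto simp: b_def cball_eq_atLeastAtMost)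

  have "continuous_on {a..b} (\<lambda>t. 1 + 2 * S t + t)"
    using dS sub
    by (intro continuous_intros continuous_at_imp_continuous_on) (blast dest: DERIV_isCont)
  then have "bounded ((\<lambda>t. 1 + 2 * S t + t) ` {a..b})"
    by (intro compact_imp_bounded compact_continuous_image) auto
  then obtain M where M: "\<And>t. t \<in> {a..b} \<Longrightarrow> \<bar>1 + 2 * S t + t\<bar> \<le> M"
    by (force simp: bounded_iff)

  define E where "E t = S t + (deriv S t)\<^sup>2 / (4 * S t)" for t
  have "\<forall>\<^sub>F t in at a. S t > 0 \<and> S differentiable (at t)"
  proof -
    have "\<forall>\<^sub>F t in at a. t \<in> I - {a}"
      using eventually_at_in_open[OF \<open>open I\<close> \<open>a \<in> I\<close>] .
    then show ?thesis
      by eventually_elim (use assms(6) dS in \<open>auto simp: real_differentiable_def\<close>)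
  qed
  from sqrt_minimum_quotient_tendsto[OF s \<open>S a = 0\<close> this]
  have "((\<lambda>t. (deriv S t)\<^sup>2 / (4 * S t)) \<longlongrightarrow> 0) (at a)" .
  moreover have "(S \<longlongrightarrow> 0) (at a)"
    using DERIV_isCont[OF dS[OF \<open>a \<in> I\<close>]] \<open>S a = 0\<close> by (simp add: isCont_def)
  ultimately have "(E \<longlongrightarrow> 0 + 0) (at a)"
    unfolding E_def by (intro tendsto_add)
  then have lim: "(E \<longlongrightarrow> 0) (at_right a)"
    by (simp add: filterlim_at_split)

  have "E b \<le> 0"
  proof (rule gronwall_zero_at_right[OF \<open>a < b\<close> _ _ lim])
    fix t assume t: "a < t" "t \<le> b"
    then have "t \<in> I" using sub by auto
    moreover from this have "S t > 0" using t assms(6)[of t] by auto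
    ultimately show "(E has_real_derivative deriv S t * (1 + 2 * S t + t)) (at t)"
      unfolding E_def by (intro XX_energy_has_derivative twice XX) auto
    have "deriv S t * (1 + 2 * S t + t) \<le> \<bar>deriv S t\<bar> * \<bar>1 + 2 * S t + t\<bar>"
      by (metis abs_ge_self abs_mult)
    also have "\<dots> \<le> E t * M"
      using M[of t] t abs_le_energy[OF \<open>S t > 0\<close>, of "deriv S t"]
      unfolding E_def by (intro mult_mono) auto
    finally show "deriv S t * (1 + 2 * S t + t) \<le> M * E t"
      by (simp add: mult.commute)
  qed
  moreover have "b \<in> I"
    using sub \<open>a < b\<close> by auto
  then have "S b > 0"
    using \<open>a < b\<close> assms(6)[of b] by auto
  then have "E b > 0"
    unfolding E_def by (intro add_pos_nonneg) auto
  ultimately show False by simp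
qed

end
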